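(* Let $m_-, m_+$ be strictly positive integers, $\phi : \{0,\ldots,m_+-1\} \to \{0,\ldots,m_--1\}$ a surjective function, and $p^+ = (p^+_0,\ldots,p^+_{m_+-1})$ a probability distribution on $\{0,\ldots,m_+-1\}$. Let $\sigma_\phi : \Sigma_{m_-,m_+} \to \Sigma_{m_-,m_+}$ be the $(m_-,m_+)$-extended shift with transition function $\phi$ and let $\mu$ be the probability measure on $\Sigma_{m_-,m_+}$ induced by $p^+$. Then the folding entropy of $\sigma_\phi$ with respect to $\mu$ is $$\mathcal F(\sigma_\phi) = H_\mu(\mathcal C_0) - H_\mu(\mathcal C_{-1}) = \sum_{s_-=0}^{m_--1} \Big( \sum_{s_+ \in \phi^{-1}(s_-)} -q^{s_-}_{s_+} \log q^{s_-}_{s_+} \Big) p^-_{s_-}.$$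
   Context: Extended shift. $\Sigma_{m_-,m_+} := \{0,\ldots,m_--1\}^{\mathbb Z_{<0}} \times \{0,\ldots,m_+-1\}^{\mathbb Z_{\ge 0}}$; its elements are written as bilateral sequences $x = (\ldots,x_{-2},x_{-1};x_0,x_1,\ldots)$ with $x_i \in \{0,\ldots,m_--1\}$ for $i<0$ and $x_i \in \{0,\ldots,m_+-1\}$ for $i \ge 0$. The map $\sigma_\phi$ is $\sigma_\phi(\ldots,x_{-2},x_{-1};x_0,x_1,\ldots) := (\ldots,x_{-1},\phi(x_0);x_1,x_2,\ldots)$. Measure. For $i \in \mathbb Z$ and $s$ a symbol of the alphabet allowed at position $i$, the cylinder is $C_i^s := \{x \in \Sigma_{m_-,m_+} : x_i = s\}$; the $\sigma$-algebra $\mathcal B$ is generated by the cylinders. The distribution $p^- = (p^-_0,\ldots,p^-_{m_--1})$ is the pushforward of $p^+$ by $\phi$: $p^-_z := \sum_{s \in \phi^{-1}(z)} p^+_s$. The measure $\mu$ induced by $p^+$ is the product measure with $\mu(C_i^s) = p^-_s$ for $i<0$ and $\mu(C_i^s) = p^+_s$ for $i \ge 0$ (so cylinders at distinct indices are independent). It is $\sigma_\phi$-invariant. Quotient distributions. For $s_- \in \{0,\ldots,m_--1\}$ and $s_+ \in \phi^{-1}(s_-)$, $q^{s_-}_{s_+} := p^+_{s_+}/p^-_{s_-}$. If $p^-_{s_-}=0$, the corresponding term of the outer sum is taken to be $0$. Partitions and entropy. $\mathcal C_0 := \{C_0^s : 0 \le s < m_+\}$ and $\mathcal C_{-1} :=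 \{C_{-1}^s : 0 \le s < m_-\}$. For a finite or countable measurable partition $\mathcal P$, $H_\mu(\mathcal P) := \sum_{P\in\mathcal P} -\mu(P)\log\mu(P)$, with $0 \log 0 = 0$. Disintegration. Let $(X,\mathcal M,\mu)$ be a probability space and $\mathcal P$ a (possibly uncountable) partition of $X$ with natural projection $\pi : X \to \mathcal P$ sending $x$ to the element containing it. Equip $\mathcal P$ with the quotient $\sigma$-algebra $\hat{\mathcal M} = \{\mathcal Q \subseteq \mathcal P : \pi^{-1}(\mathcal Q) \in \mathcal M\}$ and quotient measure $\hat\mu(\mathcal Q) = \mu(\pi^{-1}(\mathcal Q))$. A disintegration of $\mu$ with respect to $\mathcal P$ is a family of probability measures $(\mu_P)_{P \in \mathcal P}$ on $X$ (defined for $\hat\mu$-almost every $P$) such that $\mu_P(P)=1$ for almost every $P$, and for each $M \in \mathcal M$ the function $P \mapsto \mu_P(M)$ is measurable and $\mu(M) = \int_{\mathcal P} \mu_P(M)\,\hat\mu(dP)$. Conditional and folding entropy. For partitions $\mathcal P, \mathcal P'$, put $\mathcal P|_{P'} := \{P \cap P' : P \in \mathcal P\}$ for $P' \in \mathcal P'$, and $H_\mu(\mathcal P \mid \mathcal P') := \int_{\mathcal P'} H_{\mu_{P'}}(\mathcal P|_{P'})\,\hat\mu(dP')$, where $(\mu_{P'})$ is the disintegration of $\mu$ with respect to $\mathcal P'$ and $\hat\mu$ the quotient measure on $\mathcal P'$. For a measure-preserving $f : X \to X$, the folding entropy is $\mathcal F(f) := H_\mu(\epsilon \mid f^{-1}(\epsilon))$,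 where $\epsilon := \{\{x\} : x \in X\}$ is the atomic partition and $f^{-1}(\epsilon) := \{f^{-1}(x) : x \in X\}$. *)

theory Defs
  imports "HOL-Probability.Probability"
begin

section \<open>The extended shift\<close>

definition ext_shift_space :: "nat \<Rightarrow> nat \<Rightarrow> (int \<Rightarrow> nat) set" where
  "ext_shift_space m_minus m_plus =
     (\<Pi>\<^sub>E i\<in>UNIV. if i < 0 then {..<m_minus} else {..<m_plus})"

definition ext_shift :: "(nat \<Rightarrow> nat) \<Rightarrow> (int \<Rightarrow> nat) \<Rightarrow> (int \<Rightarrow> nat)" where
  "ext_shift \<phi> x = (\<lambda>i. if i = -1 then \<phi> (x 0) else x (i + 1))"

definition cylinder :: "nat \<Rightarrow> nat \<Rightarrow> int \<Rightarrow> nat \<Rightarrow> (int \<Rightarrow> nat) set" where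
  "cylinder m_minus m_plus i s = {x \<in> ext_shift_space m_minus m_plus. x i = s}"

text \<open>The distribution $p^-$ on the negative side, i.e. the pushforward of $p^+$ by $\phi$.\<close>

definition push_dist :: "nat \<Rightarrow> (nat \<Rightarrow> nat) \<Rightarrow> (nat \<Rightarrow> real) \<Rightarrow> nat \<Rightarrow> real" where
  "push_dist m_plus \<phi> p z = (\<Sum>s\<in>{s. s < m_plus \<and> \<phi> s = z}. p s)"

text \<open>If \<open>push_dist m_plus \<phi> p s_minus = 0\<close>, the quotient is \<open>0\<close> by the convention on division.\<close>

definition quot_dist ::
    "nat \<Rightarrow> (nat \<Rightarrow> nat) \<Rightarrow> (nat \<Rightarrow> real) \<Rightarrow> nat \<Rightarrow> nat \<Rightarrow> real" where
  "quot_dist m_plus \<phi> p s_minus s_plus = p s_plus / push_dist m_plus \<phi> p s_minus"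

definition ext_shift_measure ::
    "nat \<Rightarrow> nat \<Rightarrow> (nat \<Rightarrow> nat) \<Rightarrow> (nat \<Rightarrow> real) \<Rightarrow> (int \<Rightarrow> nat) measure" where
  "ext_shift_measure m_minus m_plus \<phi> p =
     (\<Pi>\<^sub>M i\<in>UNIV. if i < 0
        then point_measure {..<m_minus} (\<lambda>s. ennreal (push_dist m_plus \<phi> p s))
        else point_measure {..<m_plus} (\<lambda>s. ennreal (p s)))"

definition cyl_partition :: "nat \<Rightarrow> nat \<Rightarrow> int \<Rightarrow> (int \<Rightarrow> nat) set set" where
  "cyl_partition m_minus m_plus i =
     {cylinder m_minus m_plus i s |s. s < (if i < 0 then m_minus else m_plus)}"


section \<open>Entropy, disintegration and folding entropy\<close>

text \<open>Meant for countable measurable partitions. The summand vanishes on null sets, as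
  \<open>0 * ln 0 = 0\<close>; in particular it does not matter whether the empty set is listed as a
  member of the partition.\<close>

definition partition_entropy :: "'a measure \<Rightarrow> 'a set set \<Rightarrow> ennreal" where
  "partition_entropy M \<P> = (\<Sum>\<^sub>\<infinity>P\<in>\<P>. ennreal (- measure M P * ln (measure M P)))"

definition partition_proj :: "'a set set \<Rightarrow> 'a \<Rightarrow> 'a set" where
  "partition_proj \<P> x = (THE P. P \<in> \<P> \<and> x \<in> P)"

definition quotient_measure :: "'a measure \<Rightarrow> 'a set set \<Rightarrow> 'a set measure" where
  "quotient_measure M \<P> =
     distr M (sigma \<P> {Q. Q \<subseteq> \<P> \<and> partition_proj \<P> -` Q \<inter> space M \<in> sets M})
       (partition_proj \<P>)"

text \<open>The measures \<open>D P\<close> are only constrained for almost every \<open>P\<close>; on the exceptional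
  null set \<open>D\<close> takes arbitrary values, subject to measurability.\<close>

definition disintegration :: "'a measure \<Rightarrow> 'a set set \<Rightarrow> ('a set \<Rightarrow> 'a measure) \<Rightarrow> bool" where
  "disintegration M \<P> D \<longleftrightarrow>
     (AE P in quotient_measure M \<P>.
        prob_space (D P) \<and> sets (D P) = sets M \<and> emeasure (D P) P = 1) \<and>
     (\<forall>A\<in>sets M.
        (\<lambda>P. emeasure (D P) A) \<in> borel_measurable (quotient_measure M \<P>) \<and>
        emeasure M A = (\<integral>\<^sup>+P. emeasure (D P) A \<partial>quotient_measure M \<P>))"

definition restrict_partition :: "'a set set \<Rightarrow> 'a set \<Rightarrow> 'a set set" where
  "restrict_partition \<P> P' = {P \<inter> P' |P. P \<in> \<P>}"

text \<open>The value is well defined only if a disintegration exists and all of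
  them give the same integral.\<close>

definition cond_partition_entropy :: "'a measure \<Rightarrow> 'a set set \<Rightarrow> 'a set set \<Rightarrow> ennreal" where
  "cond_partition_entropy M \<P> \<P>' =
     (THE h. \<exists>D. disintegration M \<P>' D \<and>
        h = (\<integral>\<^sup>+P'. partition_entropy (D P') (restrict_partition \<P> P') \<partial>quotient_measure M \<P>'))"

definition atomic_partition :: "'a measure \<Rightarrow> 'a set set" where
  "atomic_partition M = {{x} |x. x \<in> space M}"

definition preimage_partition :: "'a measure \<Rightarrow> ('a \<Rightarrow> 'a) \<Rightarrow> 'a set set \<Rightarrow> 'a set set" where
  "preimage_partition M f \<P> = {f -` P \<inter> space M |P. P \<in> \<P>}"

definition folding_entropy :: "'a measure \<Rightarrow> ('a \<Rightarrow> 'a) \<Rightarrow> ennreal" where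
  "folding_entropy M f =
     cond_partition_entropy M (atomic_partition M)
       (preimage_partition M f (atomic_partition M))"

end

theory Submission
  imports Defs
begin

text \<open>
  The fibre of the extended shift through \<open>x\<close> is the finite set of points \<open>x(0 := s)\<close> with
  \<open>\<phi> s = \<phi> (x 0)\<close>. As the coordinate \<open>0\<close> is independent of all others, giving the mass
  \<open>p s / p' (\<phi> s)\<close> to \<open>x(0 := s)\<close> yields a disintegration of \<open>\<mu>\<close> along the fibres. For any
  other disintegration \<open>D\<close>, the mass that \<open>D P\<close> gives to the point of \<open>P\<close> with \<open>0\<close>-th
  coordinate \<open>s\<close> is its mass of the cylinder \<open>C\<^sub>0\<^sup>s\<close>, and for a fixed measurable set the mass is
  determined for almost every \<open>P\<close>. So all disintegrations give the entropy of \<open>q\<close> on almost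
  every fibre, and the chain rule for finite distributions finishes the proof.
\<close>

section \<open>Quotient measures and disintegrations\<close>

lemma partition_proj_eq:
  assumes "partition_on \<Omega> \<P>" "P \<in> \<P>" "x \<in> P"
  shows "partition_proj \<P> x = P"
proof -
  have "Q = P" if "Q \<in> \<P>" "x \<in> Q" for Q
    using disjointD[OF partition_onD2[OF assms(1)] \<open>Q \<in> \<P>\<close> \<open>P \<in> \<P>\<close>] that assms(3) by blast
  then show ?thesis
    unfolding partition_proj_def using assms(2,3) by (intro the_equality conjI) blast+
qed

lemma partition_proj_in:
  assumes "partition_on \<Omega> \<P>" "x \<in> \<Omega>"
  shows "partition_proj \<P> x \<in> \<P>" "x \<in> partition_proj \<P> x"
proof -
  obtain P where P: "P \<in> \<P>" "x \<in> P"
    using assms(2) unfolding partition_onD1[OF assms(1)] by blast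
  from partition_proj_eq[OF assms(1) this] P
  show "partition_proj \<P> x \<in> \<P>" "x \<in> partition_proj \<P> x"
    by simp_all
qed

lemma space_quotient_measure [simp]: "space (quotient_measure M \<P>) = \<P>"
  unfolding quotient_measure_def by (simp add: space_measure_of_conv)

text \<open>The sets with measurable preimage already form a \<sigma>-algebra, so
  \<open>sigma\<close> in the definition adds nothing to them.\<close>

lemma sets_quotient_measure:
  assumes "partition_on (space M) \<P>"
  shows "sets (quotient_measure M \<P>) =
    {Q. Q \<subseteq> \<P> \<and> partition_proj \<P> -` Q \<inter> space M \<in> sets M}"
proof -
  let ?Q = "{Q. Q \<subseteq> \<P> \<and> partition_proj \<P> -` Q \<inter> space M \<in> sets M}"
  have proj: "partition_proj \<P> -` \<P> \<inter> space M = space M"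
    using partition_proj_in[OF assms] by auto
  have "sigma_algebra \<P> ?Q"
  proof (rule sigma_algebra_iff2[THEN iffD2], safe)
    fix Q assume "partition_proj \<P> -` Q \<inter> space M \<in> sets M"
    moreover have "partition_proj \<P> -` (\<P> - Q) \<inter> space M =
        space M - (partition_proj \<P> -` Q \<inter> space M)"
      using proj by auto
    ultimately show "partition_proj \<P> -` (\<P> - Q) \<inter> space M \<in> sets M"
      by (metis sets.compl_sets)
  next
    fix A :: "nat \<Rightarrow> 'a set set"
    assume "range A \<subseteq> ?Q"
    then have "(\<Union>i. partition_proj \<P> -` A i \<inter> space M) \<in> sets M"
      by blast
    moreover have "partition_proj \<P> -` \<Union> (range A) \<inter> space M =
        (\<Union>i. partition_proj \<P> -` A i \<inter> space M)"
      by auto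
    ultimately show "partition_proj \<P> -` \<Union> (range A) \<inter> space M \<in> sets M"
      by simp
  qed auto
  then show ?thesis
    unfolding quotient_measure_def
    by (simp add: sigma_algebra.sets_measure_of_eq)
qed

lemma measurable_partition_proj:
  assumes "partition_on (space M) \<P>"
  shows "partition_proj \<P> \<in> M \<rightarrow>\<^sub>M quotient_measure M \<P>"
  using partition_proj_in[OF assms] sets_quotient_measure[OF assms]
  by (intro measurableI) auto

text \<open>With the quotient as its own target, the general facts about \<open>distr\<close> apply
  without unfolding its \<sigma>-algebra.\<close>

lemma quotient_measure_eq_distr:
  assumes "partition_on (space M) \<P>"
  shows "quotient_measure M \<P> = distr M (quotient_measure M \<P>) (partition_proj \<P>)"
  by (subst quotient_measure_def, rule distr_cong) (simp_all add: quotient_measure_def)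

text \<open>The quotient \<sigma>-algebra is the largest one that makes the projection measurable,
  so measurability on the quotient can be tested upstairs.\<close>

lemma measurable_quotient_measureI:
  assumes part: "partition_on (space M) \<P>"
    and g: "(\<lambda>x. g (partition_proj \<P> x)) \<in> M \<rightarrow>\<^sub>M N"
  shows "g \<in> quotient_measure M \<P> \<rightarrow>\<^sub>M N"
proof (rule measurableI)
  fix P assume "P \<in> space (quotient_measure M \<P>)"
  then have P: "P \<in> \<P>" by simp
  then obtain x where "x \<in> P"
    using partition_onD3[OF part] by (metis ex_in_conv)
  moreover from this P have "x \<in> space M"
    unfolding partition_onD1[OF part] by blast
  ultimately show "g P \<in> space N"
    using measurable_space[OF g] partition_proj_eq[OF part P] by auto
next
  fix A assume "A \<in> sets N"
  from measurable_sets[OF g this]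
  have "(\<lambda>x. g (partition_proj \<P> x)) -` A \<inter> space M \<in> sets M" .
  moreover have "partition_proj \<P> -` (g -` A \<inter> \<P>) \<inter> space M =
      (\<lambda>x. g (partition_proj \<P> x)) -` A \<inter> space M"
    using partition_proj_in[OF part] by auto
  ultimately show "g -` A \<inter> space (quotient_measure M \<P>) \<in> sets (quotient_measure M \<P>)"
    by (simp add: sets_quotient_measure[OF part])
qed

lemma nn_integral_quotient_measure:
  assumes part: "partition_on (space M) \<P>"
    and g: "(\<lambda>x. g (partition_proj \<P> x)) \<in> borel_measurable M"
  shows "(\<integral>\<^sup>+P. g P \<partial>quotient_measure M \<P>) = (\<integral>\<^sup>+x. g (partition_proj \<P> x) \<partial>M)"
proof -
  have "g \<in> borel_measurable (distr M (quotient_measure M \<P>) (partition_proj \<P>))"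
    using measurable_quotient_measureI[OF part g] by simp
  from nn_integral_distr[OF measurable_partition_proj[OF part] this] show ?thesis
    by (simp flip: quotient_measure_eq_distr[OF part])
qed

lemma AE_quotient_measureI:
  assumes part: "partition_on (space M) \<P>"
    and R: "Measurable.pred M (\<lambda>x. R (partition_proj \<P> x))"
    and AE: "AE x in M. R (partition_proj \<P> x)"
  shows "AE P in quotient_measure M \<P>. R P"
proof -
  have "R \<in> quotient_measure M \<P> \<rightarrow>\<^sub>M count_space UNIV"
    using R by (rule measurable_quotient_measureI[OF part])
  then have "{P \<in> space (quotient_measure M \<P>). R P} \<in> sets (quotient_measure M \<P>)"
    by (rule predE)
  from AE_distr_iff[OF measurable_partition_proj[OF part] this] AE show ?thesis
    by (subst quotient_measure_eq_distr[OF part]) blast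
qed

text \<open>Since \<open>D P\<close> lives on \<open>P\<close>, intersecting \<open>A\<close> with a saturated set multiplies
  \<open>D P A\<close> by an indicator function, so \<open>P \<mapsto> D P A\<close> is determined as a density.\<close>

lemma disintegration_set_integral:
  assumes part: "partition_on (space M) \<P>"
    and D: "disintegration M \<P> D"
    and A: "A \<in> sets M"
    and Q: "Q \<in> sets (quotient_measure M \<P>)"
  shows "(\<integral>\<^sup>+P. emeasure (D P) A * indicator Q P \<partial>quotient_measure M \<P>) =
    emeasure M (A \<inter> (partition_proj \<P> -` Q \<inter> space M))"
proof -
  let ?B = "partition_proj \<P> -` Q \<inter> space M"
  have B: "?B \<in> sets M"
    using Q sets_quotient_measure[OF part] by auto
  have "AE P in quotient_measure M \<P>.
      emeasure (D P) A * indicator Q P = emeasure (D P) (A \<inter> ?B)"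
  proof -
    have ae: "AE P in quotient_measure M \<P>.
        prob_space (D P) \<and> sets (D P) = sets M \<and> emeasure (D P) P = 1"
      using D unfolding disintegration_def by blast
    show ?thesis
    proof (rule AE_mp[OF ae], rule AE_I2, intro impI)
      fix P assume "P \<in> space (quotient_measure M \<P>)"
      then have P: "P \<in> \<P>" by simp
      assume DP: "prob_space (D P) \<and> sets (D P) = sets M \<and> emeasure (D P) P = 1"
      interpret prob_space "D P" using DP by blast
      \<comment> \<open>\<open>emeasure\<close> is 0 by default off the \<sigma>-algebra, so mass 1
        forces \<open>P\<close> to be measurable.\<close>
      have "P \<in> sets (D P)"
        using DP emeasure_notin_sets by fastforce
      then have "AE x in D P. x \<in> P"
        using DP by (intro AE_in_set_eq_1[THEN iffD2]) (auto simp: emeasure_eq_measure)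
      \<comment> \<open>\<open>?B\<close> is a union of elements of the partition, so it either
        contains \<open>P\<close> or misses it.\<close>
      moreover have "x \<in> ?B \<longleftrightarrow> P \<in> Q" if "x \<in> P" for x
        using that P partition_proj_eq[OF part P that] partition_onD1[OF part] by auto
      ultimately have "AE x in D P. x \<in> ?B \<longleftrightarrow> P \<in> Q"
        by auto
      then have "emeasure (D P) (A \<inter> ?B) = emeasure (D P) (if P \<in> Q then A else {})"
        using A B DP by (intro emeasure_eq_AE) auto
      then show "emeasure (D P) A * indicator Q P = emeasure (D P) (A \<inter> ?B)"
        by (auto split: if_splits)
    qed
  qed
  then have "(\<integral>\<^sup>+P. emeasure (D P) A * indicator Q P \<partial>quotient_measure M \<P>) =
      (\<integral>\<^sup>+P. emeasure (D P) (A \<inter> ?B) \<partial>quotient_measure M \<P>)"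
    by (rule nn_integral_cong_AE)
  also have "\<dots> = emeasure M (A \<inter> ?B)"
    using D A B unfolding disintegration_def by auto
  finally show ?thesis .
qed

text \<open>By the previous lemma both functions of \<open>P\<close> have the same integral over
  every measurable set of the quotient. The exceptional null set depends on
  \<open>A\<close>.\<close>

lemma disintegration_AE_unique:
  assumes "prob_space M"
    and part: "partition_on (space M) \<P>"
    and D: "disintegration M \<P> D" and D': "disintegration M \<P> D'"
    and A: "A \<in> sets M"
  shows "AE P in quotient_measure M \<P>. emeasure (D P) A = emeasure (D' P) A"
proof -
  interpret prob_space M by fact
  interpret Q: prob_space "quotient_measure M \<P>"
    by (subst quotient_measure_eq_distr[OF part])
      (rule prob_space_distr[OF measurable_partition_proj[OF part]])
  show ?thesis
  proof (rule Q.density_unique2)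
    show "(\<lambda>P. emeasure (D P) A) \<in> borel_measurable (quotient_measure M \<P>)"
      "(\<lambda>P. emeasure (D' P) A) \<in> borel_measurable (quotient_measure M \<P>)"
      using D D' A unfolding disintegration_def by blast+
    show "(\<integral>\<^sup>+P\<in>Q. emeasure (D P) A \<partial>quotient_measure M \<P>) =
        (\<integral>\<^sup>+P\<in>Q. emeasure (D' P) A \<partial>quotient_measure M \<P>)"
      if "Q \<in> sets (quotient_measure M \<P>)" for Q
      using disintegration_set_integral[OF part _ A that] D D' by simp
  qed
qed

section \<open>Evaluation of conditional entropies\<close>

lemma cond_partition_entropy_eqI:
  assumes "disintegration M \<P>' D"
    and "\<And>D. disintegration M \<P>' D \<Longrightarrow>
      (\<integral>\<^sup>+P'. partition_entropy (D P') (restrict_partition \<P> P') \<partial>quotient_measure M \<P>') = h"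
  shows "cond_partition_entropy M \<P> \<P>' = h"
  unfolding cond_partition_entropy_def using assms by (intro the_equality) auto

text \<open>Points outside \<open>P\<close> leave the empty trace, whose summand is 0; the other
  traces are the singletons of \<open>P\<close>.\<close>

lemma partition_entropy_atomic:
  assumes "P \<subseteq> space M" "finite P"
  shows "partition_entropy N (restrict_partition (atomic_partition M) P) =
    (\<Sum>x\<in>P. ennreal (- measure N {x} * ln (measure N {x})))"
proof -
  let ?h = "\<lambda>A. ennreal (- measure N A * ln (measure N A))"
  have "infsum ?h (restrict_partition (atomic_partition M) P) = infsum ?h ((\<lambda>x. {x}) ` P)"
  proof (rule infsum_cong_neutral)
    show "?h A = 0" if "A \<in> (\<lambda>x. {x}) ` P - restrict_partition (atomic_partition M) P" for A
      using that assms(1) unfolding restrict_partition_def atomic_partition_def by blast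
    show "?h A = 0" if "A \<in> restrict_partition (atomic_partition M) P - (\<lambda>x. {x}) ` P" for A
    proof -
      have "A = {}"
        using that unfolding restrict_partition_def atomic_partition_def by auto
      then show ?thesis by simp
    qed
  qed simp
  also have "\<dots> = (\<Sum>x\<in>P. ?h {x})"
    using assms(2) by (simp add: sum.reindex inj_on_def)
  finally show ?thesis
    unfolding partition_entropy_def .
qed

section \<open>The extended shift\<close>

locale extended_shift =
  fixes m_minus m_plus :: nat and \<phi> :: "nat \<Rightarrow> nat" and p :: "nat \<Rightarrow> real"
  assumes m_plus_pos: "m_plus > 0"
    and image_\<phi>: "\<phi> ` {..<m_plus} = {..<m_minus}"
    and p_nonneg: "\<And>s. s < m_plus \<Longrightarrow> 0 \<le> p s"
    and sum_p: "(\<Sum>s<m_plus. p s) = 1"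
begin

abbreviation \<mu> :: "(int \<Rightarrow> nat) measure" where
  "\<mu> \<equiv> ext_shift_measure m_minus m_plus \<phi> p"

abbreviation p' :: "nat \<Rightarrow> real" where
  "p' \<equiv> push_dist m_plus \<phi> p"

abbreviation q :: "nat \<Rightarrow> nat \<Rightarrow> real" where
  "q \<equiv> quot_dist m_plus \<phi> p"

text \<open>Indexing alphabets and weights by the position turns \<open>\<mu>\<close> into the
  product of the single family \<open>factor\<close>, so that both halves are treated alike.\<close>

definition alphabet :: "int \<Rightarrow> nat" where
  "alphabet i = (if i < 0 then m_minus else m_plus)"

definition weight :: "int \<Rightarrow> nat \<Rightarrow> real" where
  "weight i = (if i < 0 then p' else p)"

definition factor :: "int \<Rightarrow> nat measure" where
  "factor i = point_measure {..<alphabet i} (\<lambda>s. ennreal (weight i s))"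

lemma alphabet_0 [simp]: "alphabet 0 = m_plus"
  by (simp add: alphabet_def)

lemma \<phi>_less: "s < m_plus \<Longrightarrow> \<phi> s < m_minus"
  using image_\<phi> by blast

lemma alphabet_pos: "alphabet i > 0"
  using m_plus_pos \<phi>_less[OF m_plus_pos] by (auto simp: alphabet_def)

lemma p'_nonneg: "0 \<le> p' z"
  unfolding push_dist_def by (intro sum_nonneg) (auto simp: p_nonneg)

lemma sum_fibres: "(\<Sum>z<m_minus. \<Sum>s | s < m_plus \<and> \<phi> s = z. h s) = (\<Sum>s<m_plus. h s)"
  for h :: "nat \<Rightarrow> 'b::comm_monoid_add"
  using sum.group[of "{..<m_plus}" "{..<m_minus}" \<phi> h] image_\<phi> by simp

lemma p_le_p': "s < m_plus \<Longrightarrow> p s \<le> p' (\<phi> s)"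
  unfolding push_dist_def by (rule member_le_sum) (auto simp: p_nonneg)

text \<open>Where \<open>p' (\<phi> s)\<close> vanishes, so does the smaller \<open>p s\<close>;
  cancelling is therefore valid even under the convention for division by zero.\<close>

lemma q_mult_p': "s < m_plus \<Longrightarrow> q (\<phi> s) s * p' (\<phi> s) = p s"
  using p_le_p'[of s] p_nonneg[of s] by (auto simp: quot_dist_def)

lemma q_nonneg: "s < m_plus \<Longrightarrow> 0 \<le> q z s"
  by (simp add: quot_dist_def p_nonneg p'_nonneg)

lemma sum_q: "p' z \<noteq> 0 \<Longrightarrow> (\<Sum>s | s < m_plus \<and> \<phi> s = z. q z s) = 1"
  by (simp add: quot_dist_def push_dist_def flip: sum_divide_distrib)

lemma q_le_1: "s < m_plus \<Longrightarrow> q (\<phi> s) s \<le> 1"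
  using p_le_p'[of s] p'_nonneg[of "\<phi> s"] by (auto simp: quot_dist_def divide_le_eq_1)

lemma weight_nonneg: "s < alphabet i \<Longrightarrow> 0 \<le> weight i s"
  by (auto simp: weight_def alphabet_def p_nonneg p'_nonneg)

lemma sum_weight: "(\<Sum>s<alphabet i. weight i s) = 1"
  using sum_p sum_fibres[of p] by (simp add: weight_def alphabet_def push_dist_def)

lemma weight_le_1: "s < alphabet i \<Longrightarrow> weight i s \<le> 1"
  using member_le_sum[of s "{..<alphabet i}" "weight i"] sum_weight[of i]
  by (auto simp: weight_nonneg)

lemma prob_space_factor: "prob_space (factor i)"
  unfolding factor_def
proof (rule prob_space_point_measure)
  show "(\<Sum>s<alphabet i. ennreal (weight i s)) = 1"
    using sum_weight[of i] by (subst sum_ennreal) (auto simp: weight_nonneg)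
qed simp_all

lemma space_factor [simp]: "space (factor i) = {..<alphabet i}"
  and sets_factor [simp]: "sets (factor i) = Pow {..<alphabet i}"
  by (simp_all add: factor_def space_point_measure sets_point_measure)

lemma measure_factor: "s < alphabet i \<Longrightarrow> measure (factor i) {s} = weight i s"
  unfolding factor_def measure_def
  by (subst emeasure_point_measure_finite) (auto simp: weight_nonneg)

lemma \<mu>_eq: "\<mu> = PiM UNIV factor"
  unfolding ext_shift_measure_def by (intro PiM_cong) (auto simp: factor_def alphabet_def weight_def)

lemma prob_space_\<mu>: "prob_space \<mu>"
  unfolding \<mu>_eq by (intro prob_space_PiM prob_space_factor)

lemma space_\<mu>: "space \<mu> = {x. \<forall>i. x i < alphabet i}"
  unfolding \<mu>_eq by (auto simp: space_PiM PiE_iff)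

lemma ext_shift_space_eq: "ext_shift_space m_minus m_plus = space \<mu>"
  unfolding space_\<mu> ext_shift_space_def by (auto simp: PiE_iff alphabet_def) (metis lessThan_iff)+

lemma cylinder_eq: "cylinder m_minus m_plus i s = (\<lambda>x. x i) -` {s} \<inter> space \<mu>"
  unfolding cylinder_def ext_shift_space_eq by auto

lemma measurable_coord [measurable]: "(\<lambda>x. x i) \<in> \<mu> \<rightarrow>\<^sub>M factor i"
  unfolding \<mu>_eq by (rule measurable_component_singleton) simp

lemma sets_cylinder: "s < alphabet i \<Longrightarrow> cylinder m_minus m_plus i s \<in> sets \<mu>"
  unfolding cylinder_eq by (rule measurable_sets[OF measurable_coord]) simp

lemma measure_cylinder:
  assumes "s < alphabet i"
  shows "measure \<mu> (cylinder m_minus m_plus i s) = weight i s"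
proof -
  have "distr \<mu> (factor i) (\<lambda>x. x i) = factor i"
    unfolding \<mu>_eq by (rule distr_PiM_component) (simp_all add: prob_space_factor)
  then have "measure (factor i) {s} = measure (distr \<mu> (factor i) (\<lambda>x. x i)) {s}"
    by simp
  also have "\<dots> = measure \<mu> (cylinder m_minus m_plus i s)"
    unfolding cylinder_eq using assms by (intro measure_distr measurable_coord) auto
  finally show ?thesis
    using measure_factor[OF assms] by simp
qed

lemma weight_entropy_nonneg: "s < alphabet i \<Longrightarrow> 0 \<le> - weight i s * ln (weight i s)"
  using weight_nonneg[of s i] weight_le_1[of s i]
  by (cases "weight i s = 0") (auto intro!: mult_nonneg_nonpos)

lemma partition_entropy_cylinders:
  "partition_entropy \<mu> (cyl_partition m_minus m_plus i) =
    ennreal (\<Sum>s<alphabet i. - weight i s * ln (weight i s))"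
proof -
  have eq: "cyl_partition m_minus m_plus i = cylinder m_minus m_plus i ` {..<alphabet i}"
    unfolding cyl_partition_def alphabet_def by auto
  have "inj_on (cylinder m_minus m_plus i) {..<alphabet i}"
  proof (rule inj_onI)
    fix s t assume s: "s \<in> {..<alphabet i}"
      and st: "cylinder m_minus m_plus i s = cylinder m_minus m_plus i t"
    \<comment> \<open>Distinct symbols give distinct cylinders because each cylinder is inhabited.
      The symbol 0 is allowed everywhere, as no alphabet is empty.\<close>
    have "(\<lambda>_. 0)(i := s) \<in> cylinder m_minus m_plus i s"
      using s alphabet_pos by (auto simp: cylinder_eq space_\<mu>)
    then show "s = t"
      unfolding st by (simp add: cylinder_eq)
  qed
  then show ?thesis
    unfolding partition_entropy_def eq using weight_entropy_nonneg
    by (subst sum_ennreal[symmetric]) (auto simp: sum.reindex measure_cylinder)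
qed

section \<open>Independence of coordinate 0\<close>

lemma nn_integral_split:
  assumes h: "h \<in> borel_measurable \<mu>"
  shows "(\<integral>\<^sup>+x. h x \<partial>\<mu>) =
    (\<Sum>t<m_plus. ennreal (p t) * (\<integral>\<^sup>+X. h (X(0 := t)) \<partial>PiM (UNIV - {0}) factor))"
proof -
  let ?R = "PiM (UNIV - {0}) factor"
  interpret R: prob_space ?R
    by (intro prob_space_PiM prob_space_factor)
  \<comment> \<open>Inserting coordinate 0 into a sequence over the other indices carries the
    product of the two marginals to \<open>\<mu>\<close>; what remains is Fubini.\<close>
  have \<mu>: "\<mu> = distr (factor 0 \<Otimes>\<^sub>M ?R) \<mu> (\<lambda>(x, X). X(0 := x))"
    using distr_pair_PiM_eq_PiM[of "UNIV - {0}" factor 0] prob_space_factor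
    by (simp add: \<mu>_eq insert_absorb)
  have upd: "(\<lambda>(x, X). X(0 := x)) \<in> factor 0 \<Otimes>\<^sub>M ?R \<rightarrow>\<^sub>M \<mu>"
    unfolding \<mu>_eq case_prod_beta by (rule measurable_fun_upd[where J="UNIV - {0}"]) auto
  have "(\<integral>\<^sup>+x. h x \<partial>\<mu>) = (\<integral>\<^sup>+z. h ((\<lambda>(x, X). X(0 := x)) z) \<partial>(factor 0 \<Otimes>\<^sub>M ?R))"
    by (subst \<mu>, rule nn_integral_distr[OF upd]) (use h in simp)
  also have "\<dots> = (\<integral>\<^sup>+t. \<integral>\<^sup>+X. h (X(0 := t)) \<partial>?R \<partial>factor 0)"
    using R.nn_integral_fst[OF measurable_compose[OF upd h]] by simp
  also have "\<dots> = (\<Sum>t<m_plus. ennreal (p t) * (\<integral>\<^sup>+X. h (X(0 := t)) \<partial>?R))"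
    by (simp add: factor_def nn_integral_point_measure_finite alphabet_def weight_def)
  finally show ?thesis .
qed

lemma measurable_upd [measurable]:
  assumes "s < m_plus"
  shows "(\<lambda>x. x(0 := s)) \<in> \<mu> \<rightarrow>\<^sub>M \<mu>"
  unfolding \<mu>_eq
proof (rule measurable_fun_upd[where J=UNIV])
  show "(\<lambda>_. s) \<in> PiM UNIV factor \<rightarrow>\<^sub>M factor 0"
    using assms by (intro measurable_const) (simp add: alphabet_def)
qed simp_all

subsection \<open>The partition into fibres\<close>

abbreviation fibres :: "(int \<Rightarrow> nat) set set" where
  "fibres \<equiv> preimage_partition \<mu> (ext_shift \<phi>) (atomic_partition \<mu>)"

definition fibre :: "(int \<Rightarrow> nat) \<Rightarrow> (int \<Rightarrow> nat) set" where
  "fibre x = (\<lambda>s. x(0 := s)) ` {s. s < m_plus \<and> \<phi> s = \<phi> (x 0)}"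

text \<open>Each coordinate \<open>i\<close> other than 0 survives at index \<open>i - 1\<close>,
  while \<open>x 0\<close> leaves only its image under \<open>\<phi>\<close>, at index -1.\<close>

lemma ext_shift_eq_iff:
  "ext_shift \<phi> x = ext_shift \<phi> y \<longleftrightarrow> \<phi> (x 0) = \<phi> (y 0) \<and> (\<forall>i. i \<noteq> 0 \<longrightarrow> x i = y i)"
proof safe
  assume eq: "ext_shift \<phi> x = ext_shift \<phi> y"
  show "\<phi> (x 0) = \<phi> (y 0)"
    using fun_cong[OF eq, of "-1"] by (simp add: ext_shift_def)
  show "x i = y i" if "i \<noteq> 0" for i
    using fun_cong[OF eq, of "i - 1"] that by (simp add: ext_shift_def)
qed (auto simp: ext_shift_def fun_eq_iff)

lemma upd_in_space: "x \<in> space \<mu> \<Longrightarrow> s < m_plus \<Longrightarrow> x(0 := s) \<in> space \<mu>"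
  by (auto simp: space_\<mu>)

lemma mem_fibre_iff:
  assumes "x \<in> space \<mu>"
  shows "y \<in> fibre x \<longleftrightarrow> y \<in> space \<mu> \<and> ext_shift \<phi> y = ext_shift \<phi> x"
proof
  assume "y \<in> fibre x"
  then show "y \<in> space \<mu> \<and> ext_shift \<phi> y = ext_shift \<phi> x"
    using upd_in_space[OF assms] by (auto simp: fibre_def ext_shift_eq_iff)
next
  assume y: "y \<in> space \<mu> \<and> ext_shift \<phi> y = ext_shift \<phi> x"
  then have "y 0 < m_plus"
    by (metis (mono_tags) alphabet_0 mem_Collect_eq space_\<mu>)
  moreover have "y = x(0 := y 0)" "\<phi> (y 0) = \<phi> (x 0)"
    using y by (auto simp: ext_shift_eq_iff)
  ultimately show "y \<in> fibre x"
    unfolding fibre_def by blast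
qed

lemma ext_shift_in_space:
  assumes "x \<in> space \<mu>"
  shows "ext_shift \<phi> x \<in> space \<mu>"
proof -
  have *: "x i < alphabet i" for i
    using assms by (simp add: space_\<mu>)
  have "ext_shift \<phi> x i < alphabet i" for i
    using *[of 0] *[of "i + 1"] \<phi>_less[of "x 0"]
    by (auto simp: ext_shift_def alphabet_def split: if_splits)
  then show ?thesis
    by (simp add: space_\<mu>)
qed

lemma ext_shift_surj:
  assumes "x \<in> space \<mu>"
  obtains y where "y \<in> space \<mu>" "ext_shift \<phi> y = x"
proof -
  have *: "x i < alphabet i" for i
    using assms by (simp add: space_\<mu>)
  have "x (-1) \<in> \<phi> ` {..<m_plus}"
    using *[of "-1"] by (simp add: image_\<phi> alphabet_def)
  then obtain s where s: "s < m_plus" "\<phi> s = x (-1)"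
    by auto
  \<comment> \<open>Shifting back changes the alphabet only at index 0, where the symbol
    \<open>x (-1)\<close> must be replaced by a preimage under \<open>\<phi>\<close>.\<close>
  define y where "y = (\<lambda>i. if i = 0 then s else x (i - 1))"
  have "y i < alphabet i" for i
    using *[of "i - 1"] s by (auto simp: y_def alphabet_def)
  moreover have "ext_shift \<phi> y = x"
    using s by (auto simp: y_def ext_shift_def fun_eq_iff)
  ultimately show ?thesis
    using that[of y] by (simp add: space_\<mu>)
qed

text \<open>As the shift is onto, every base point has the form \<open>ext_shift \<phi> x\<close>;
  so no preimage is empty, and each is the fibre through a point.\<close>

lemma fibres_eq: "fibres = fibre ` space \<mu>"
proof -
  have fib: "ext_shift \<phi> -` {ext_shift \<phi> x} \<inter> space \<mu> = fibre x" if "x \<in> space \<mu>" for x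
    using mem_fibre_iff[OF that] by auto
  have "fibres = (\<lambda>y. ext_shift \<phi> -` {y} \<inter> space \<mu>) ` space \<mu>" (is "_ = ?F ` _")
    unfolding preimage_partition_def atomic_partition_def by auto
  moreover have "space \<mu> = ext_shift \<phi> ` space \<mu>"
    using ext_shift_in_space ext_shift_surj by (auto simp: image_iff) metis
  ultimately have "fibres = ?F ` ext_shift \<phi> ` space \<mu>"
    by metis
  then show ?thesis
    using fib by (simp add: image_image)
qed

lemma self_in_fibre: "x \<in> space \<mu> \<Longrightarrow> x \<in> fibre x"
  by (simp add: mem_fibre_iff)

lemma partition_on_fibres: "partition_on (space \<mu>) fibres"
  unfolding fibres_eq
proof (rule partition_onI)
  show "\<Union> (fibre ` space \<mu>) = space \<mu>"
    using mem_fibre_iff self_in_fibre by blast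
  show "disjnt P Q" if "P \<in> fibre ` space \<mu>" "Q \<in> fibre ` space \<mu>" "P \<noteq> Q" for P Q
    using that by (auto simp: disjnt_iff mem_fibre_iff)
  show "{} \<notin> fibre ` space \<mu>"
    using self_in_fibre by fastforce
qed

lemma proj_fibres: "x \<in> space \<mu> \<Longrightarrow> partition_proj fibres x = fibre x"
  by (intro partition_proj_eq[OF partition_on_fibres] self_in_fibre) (simp_all add: fibres_eq)

text \<open>A disintegration is indexed by sets, so building one on a fibre calls for a chosen point
  of it.\<close>

definition representative :: "(int \<Rightarrow> nat) set \<Rightarrow> (int \<Rightarrow> nat)" where
  "representative P = (SOME y. y \<in> P)"

lemma representative_in_fibre: "x \<in> space \<mu> \<Longrightarrow> representative (fibre x) \<in> fibre x"
  unfolding representative_def by (rule someI[where P="\<lambda>y. y \<in> fibre x"]) (rule self_in_fibre)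

text \<open>Points of one fibre share all coordinates other than 0 and the image of coordinate 0
  under \<open>\<phi>\<close>. Whatever uses only these data is independent of the choice of the
  point.\<close>

lemma representative_fibre:
  assumes "x \<in> space \<mu>"
  shows "\<phi> (representative (fibre x) 0) = \<phi> (x 0)"
    "(representative (fibre x))(0 := s) = x(0 := s)"
  using representative_in_fibre[OF assms] by (auto simp: fibre_def)

text \<open>There are countably many indices, so a point is a countable intersection of
  cylinders.\<close>

lemma sets_singleton:
  assumes "x \<in> space \<mu>"
  shows "{x} \<in> sets \<mu>"
proof -
  have "(\<Pi>\<^sub>E i\<in>UNIV. {x i}) \<in> sets \<mu>"
    unfolding \<mu>_eq using assms by (intro sets_PiM_I_countable) (auto simp: space_\<mu>)
  moreover have "(\<Pi>\<^sub>E i\<in>UNIV. {x i}) = {x}"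
    by (auto simp: PiE_iff fun_eq_iff)
  ultimately show ?thesis by simp
qed

lemma finite_fibre: "finite (fibre x)"
  by (simp add: fibre_def)

lemma sets_fibre:
  assumes "x \<in> space \<mu>"
  shows "fibre x \<in> sets \<mu>"
proof -
  have "(\<Union>y\<in>fibre x. {y}) \<in> sets \<mu>"
    using assms by (intro sets.finite_UN finite_fibre sets_singleton) (simp add: mem_fibre_iff)
  then show ?thesis by simp
qed

subsection \<open>The disintegration along the fibres\<close>

text \<open>The conditional law of coordinate 0, transported to the fibre. If \<open>p'\<close>
  vanishes at the common image under \<open>\<phi>\<close>, all quotients are 0 and this is the zero
  measure; such fibres together form a null set.\<close>

definition fibre_measure :: "(int \<Rightarrow> nat) set \<Rightarrow> (int \<Rightarrow> nat) measure" where
  "fibre_measure P =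
    (let y = representative P
     in distr (point_measure {..<m_plus} (\<lambda>s. if \<phi> s = \<phi> (y 0) then ennreal (q (\<phi> s) s) else 0))
          \<mu> (\<lambda>s. y(0 := s)))"

lemma emeasure_fibre_measure:
  assumes x: "x \<in> space \<mu>" and A: "A \<in> sets \<mu>"
  shows "emeasure (fibre_measure (fibre x)) A =
    (\<Sum>s | s < m_plus \<and> \<phi> s = \<phi> (x 0). ennreal (q (\<phi> s) s) * indicator A (x(0 := s)))"
proof -
  let ?y = "representative (fibre x)"
  let ?w = "\<lambda>s. if \<phi> s = \<phi> (?y 0) then ennreal (q (\<phi> s) s) else 0"
  let ?u = "\<lambda>s. ?y(0 := s)"
  have y: "?y \<in> space \<mu>"
    using representative_in_fibre[OF x] mem_fibre_iff[OF x] by blast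
  have u: "?u \<in> point_measure {..<m_plus} ?w \<rightarrow>\<^sub>M \<mu>"
    using y by (auto intro!: upd_in_space)
  \<comment> \<open>As an integral of an indicator, the mass passes through the image measure and
    becomes a finite sum over symbols.\<close>
  have "emeasure (fibre_measure (fibre x)) A = (\<integral>\<^sup>+z. indicator A z \<partial>fibre_measure (fibre x))"
    using A by (simp add: fibre_measure_def Let_def)
  also have "\<dots> = (\<integral>\<^sup>+s. indicator A (?u s) \<partial>point_measure {..<m_plus} ?w)"
    unfolding fibre_measure_def Let_def
    by (rule nn_integral_distr[OF u]) (use A in simp)
  also have "\<dots> = (\<Sum>s<m_plus. ?w s * indicator A (?u s))"
    by (rule nn_integral_point_measure_finite) simp
  also have "\<dots> = (\<Sum>s | s < m_plus \<and> \<phi> s = \<phi> (x 0). ennreal (q (\<phi> s) s) * indicator A (x(0 := s)))"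
    using y by (intro sum.mono_neutral_cong_right) (auto simp: representative_fibre[OF x])
  finally show ?thesis .
qed

lemma sets_fibre_measure [simp]: "sets (fibre_measure P) = sets \<mu>"
  by (simp add: fibre_measure_def Let_def)

text \<open>Any superset \<open>A\<close> of the fibre is allowed so as to cover both the total mass
  and the mass of the fibre itself.\<close>

lemma emeasure_fibre_measure_eq_1:
  assumes x: "x \<in> space \<mu>" and "p' (\<phi> (x 0)) \<noteq> 0" and "A \<in> sets \<mu>" "fibre x \<subseteq> A"
  shows "emeasure (fibre_measure (fibre x)) A = 1"
proof -
  have "emeasure (fibre_measure (fibre x)) A =
      (\<Sum>s | s < m_plus \<and> \<phi> s = \<phi> (x 0). ennreal (q (\<phi> (x 0)) s))"
    unfolding emeasure_fibre_measure[OF assms(1,3)]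
    using assms(4) by (intro sum.cong) (auto simp: fibre_def)
  also have "\<dots> = 1"
    using sum_q[OF assms(2)] by (subst sum_ennreal) (auto simp: q_nonneg)
  finally show ?thesis .
qed

text \<open>The cylinder meets the fibre in the single point \<open>x(0 := s)\<close>. Other
  disintegrations are compared with this value.\<close>

lemma emeasure_fibre_measure_cylinder:
  assumes "x \<in> space \<mu>" "s < m_plus" "\<phi> s = \<phi> (x 0)"
  shows "emeasure (fibre_measure (fibre x)) (cylinder m_minus m_plus 0 s) = ennreal (q (\<phi> s) s)"
proof -
  have cyl: "cylinder m_minus m_plus 0 s \<in> sets \<mu>"
    using assms by (intro sets_cylinder) simp
  have "emeasure (fibre_measure (fibre x)) (cylinder m_minus m_plus 0 s) =
      (\<Sum>t | t < m_plus \<and> \<phi> t = \<phi> (x 0). if t = s then ennreal (q (\<phi> t) t) else 0)"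
    unfolding emeasure_fibre_measure[OF assms(1) cyl]
    using upd_in_space[OF assms(1)]
    by (intro sum.cong refl) (auto simp: cylinder_eq)
  also have "\<dots> = ennreal (q (\<phi> s) s)"
    using assms by (subst sum.delta) auto
  finally show ?thesis .
qed

text \<open>Each \<open>factor i\<close> carries the discrete \<sigma>-algebra, so any function of
  one coordinate is measurable.\<close>

lemma measurable_coord_comp:
  "range f \<subseteq> space N \<Longrightarrow> (\<lambda>x. f (x i)) \<in> \<mu> \<rightarrow>\<^sub>M N"
  by (rule measurable_compose[OF measurable_coord]) (auto simp: factor_def)

lemma nn_integral_coord: "(\<integral>\<^sup>+x. g (x 0) \<partial>\<mu>) = (\<Sum>t<m_plus. ennreal (p t) * g t)"
proof -
  interpret R: prob_space "PiM (UNIV - {0}) factor"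
    by (intro prob_space_PiM prob_space_factor)
  show ?thesis
    by (subst nn_integral_split) (auto intro!: measurable_coord_comp simp: R.emeasure_space_1)
qed

text \<open>A symbol \<open>s\<close> with \<open>p' (\<phi> s) = 0\<close> has
  \<open>p s = 0\<close>, so it almost surely does not occur at index 0.\<close>

lemma AE_p'_pos: "AE x in \<mu>. p' (\<phi> (x 0)) \<noteq> 0"
proof -
  have "AE s in factor 0. p' (\<phi> s) \<noteq> 0"
    unfolding factor_def AE_point_measure using p_le_p'
    by (fastforce simp: alphabet_def weight_def)
  then show ?thesis
    unfolding \<mu>_eq by (rule AE_PiM_component[OF prob_space_factor, rotated]) simp_all
qed

lemma measurable_fibre_measure:
  assumes A: "A \<in> sets \<mu>"
  shows "(\<lambda>x. emeasure (fibre_measure (partition_proj fibres x)) A) \<in> borel_measurable \<mu>"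
proof -
  have [measurable]: "(\<lambda>x. indicator A (x(0 := s)) :: ennreal) \<in> borel_measurable \<mu>"
    if "s < m_plus" for s
    using measurable_compose[OF measurable_upd[OF that] borel_measurable_indicator[OF A]] .
  have [measurable]: "(\<lambda>x. if \<phi> s = \<phi> (x 0) then ennreal (q (\<phi> s) s) else 0) \<in> borel_measurable \<mu>" for s
    by (rule measurable_coord_comp) simp
  \<comment> \<open>The index set of the sum for the mass varies with \<open>x\<close>. Summing over
    all symbols, with the condition moved into the summand, makes measurability a termwise
    matter.\<close>
  have "(\<lambda>x. \<Sum>s<m_plus. (if \<phi> s = \<phi> (x 0) then ennreal (q (\<phi> s) s) else 0) *
      indicator A (x(0 := s))) \<in> borel_measurable \<mu>"
    by (intro borel_measurable_sum borel_measurable_times_ennreal) simp_all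
  moreover have "emeasure (fibre_measure (partition_proj fibres x)) A =
      (\<Sum>s<m_plus. (if \<phi> s = \<phi> (x 0) then ennreal (q (\<phi> s) s) else 0) * indicator A (x(0 := s)))"
    if x: "x \<in> space \<mu>" for x
    unfolding proj_fibres[OF x] emeasure_fibre_measure[OF x A]
    by (intro sum.mono_neutral_cong_left) auto
  ultimately show ?thesis
    by (simp cong: measurable_cong)
qed

text \<open>After integrating out the other coordinates, the mass of the fibre depends on the symbol
  \<open>t\<close> at index 0 only through \<open>\<phi> t\<close>. Summing over \<open>t\<close>
  first then collects the weight \<open>p' (\<phi> s)\<close> in front of each
  \<open>q (\<phi> s) s\<close>.\<close>

lemma integral_fibre_measure:
  assumes A: "A \<in> sets \<mu>"
  shows "(\<integral>\<^sup>+P. emeasure (fibre_measure P) A \<partial>quotient_measure \<mu> fibres) = emeasure \<mu> A"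
proof -
  let ?R = "PiM (UNIV - {0}) factor"
  let ?I = "\<lambda>s. \<integral>\<^sup>+X. indicator A (X(0 := s)) \<partial>?R"
  let ?k = "\<lambda>x. emeasure (fibre_measure (partition_proj fibres x)) A"
  have meas_upd: "(\<lambda>X. X(0 := s)) \<in> ?R \<rightarrow>\<^sub>M \<mu>" if "s < m_plus" for s
    unfolding \<mu>_eq
  proof (rule measurable_fun_upd[where J="UNIV - {0}"])
    show "(\<lambda>_. s) \<in> ?R \<rightarrow>\<^sub>M factor 0"
      using that by (intro measurable_const) simp
  qed auto
  note upd = measurable_space[OF meas_upd]
  have [measurable]: "(\<lambda>X. indicator A (X(0 := s)) :: ennreal) \<in> borel_measurable ?R"
    if "s < m_plus" for s
    using measurable_compose[OF meas_upd[OF that] borel_measurable_indicator[OF A]] .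
  have "(\<integral>\<^sup>+P. emeasure (fibre_measure P) A \<partial>quotient_measure \<mu> fibres) = (\<integral>\<^sup>+x. ?k x \<partial>\<mu>)"
    by (rule nn_integral_quotient_measure[OF partition_on_fibres measurable_fibre_measure[OF A]])
  also have "\<dots> = (\<Sum>t<m_plus. ennreal (p t) * (\<integral>\<^sup>+X. ?k (X(0 := t)) \<partial>?R))"
    by (rule nn_integral_split[OF measurable_fibre_measure[OF A]])
  also have "\<dots> = (\<Sum>t<m_plus. ennreal (p t) *
      (\<Sum>s | s < m_plus \<and> \<phi> s = \<phi> t. ennreal (q (\<phi> s) s) * ?I s))"
  proof (intro sum.cong refl arg_cong[where f="(*) _"])
    fix t assume "t \<in> {..<m_plus}"
    then have t: "t < m_plus" by simp
    have "(\<integral>\<^sup>+X. ?k (X(0 := t)) \<partial>?R) = (\<integral>\<^sup>+X. (\<Sum>s | s < m_plus \<and> \<phi> s = \<phi> t.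
        ennreal (q (\<phi> s) s) * indicator A (X(0 := s))) \<partial>?R)"
      using upd[OF t]
      by (intro nn_integral_cong) (simp add: proj_fibres emeasure_fibre_measure A)
    also have "\<dots> = (\<Sum>s | s < m_plus \<and> \<phi> s = \<phi> t. ennreal (q (\<phi> s) s) * ?I s)"
      by (subst nn_integral_sum) (auto intro!: sum.cong simp: nn_integral_cmult)
    finally show "(\<integral>\<^sup>+X. ?k (X(0 := t)) \<partial>?R) =
        (\<Sum>s | s < m_plus \<and> \<phi> s = \<phi> t. ennreal (q (\<phi> s) s) * ?I s)" .
  qed
  \<comment> \<open>Both sums are extended to all symbols so that their order can be
    exchanged.\<close>
  also have "\<dots> = (\<Sum>t<m_plus. \<Sum>s<m_plus.
      if \<phi> s = \<phi> t then ennreal (p t) * (ennreal (q (\<phi> s) s) * ?I s) else 0)"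
    unfolding sum_distrib_left by (intro sum.cong refl sum.mono_neutral_cong_left) auto
  also have "\<dots> = (\<Sum>s<m_plus. \<Sum>t<m_plus.
      if \<phi> s = \<phi> t then ennreal (p t) * (ennreal (q (\<phi> s) s) * ?I s) else 0)"
    by (rule sum.swap)
  also have "\<dots> = (\<Sum>s<m_plus. ennreal (p s) * ?I s)"
  proof (intro sum.cong refl)
    fix s assume "s \<in> {..<m_plus}"
    then have s: "s < m_plus" by simp
    have "(\<Sum>t<m_plus. if \<phi> s = \<phi> t then ennreal (p t) * (ennreal (q (\<phi> s) s) * ?I s) else 0) =
        (\<Sum>t | t < m_plus \<and> \<phi> t = \<phi> s. ennreal (p t) * (ennreal (q (\<phi> s) s) * ?I s))"
      by (intro sum.mono_neutral_cong_right) auto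
    also have "\<dots> = (\<Sum>t | t < m_plus \<and> \<phi> t = \<phi> s. ennreal (p t)) * (ennreal (q (\<phi> s) s) * ?I s)"
      by (rule sum_distrib_right[symmetric])
    also have "(\<Sum>t | t < m_plus \<and> \<phi> t = \<phi> s. ennreal (p t)) = ennreal (p' (\<phi> s))"
      unfolding push_dist_def by (rule sum_ennreal) (simp add: p_nonneg)
    also have "ennreal (p' (\<phi> s)) * (ennreal (q (\<phi> s) s) * ?I s) = ennreal (p s) * ?I s"
      using q_mult_p'[OF s] q_nonneg[OF s] p'_nonneg
      by (simp add: mult.assoc[symmetric] ennreal_mult[symmetric] mult.commute)
    finally show "(\<Sum>t<m_plus. if \<phi> s = \<phi> t then ennreal (p t) * (ennreal (q (\<phi> s) s) * ?I s) else 0) =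
        ennreal (p s) * ?I s" .
  qed
  also have "\<dots> = (\<integral>\<^sup>+x. indicator A x \<partial>\<mu>)"
    by (rule nn_integral_split[symmetric]) (use A in simp)
  finally show ?thesis
    using A by simp
qed

lemma disintegration_fibre_measure: "disintegration \<mu> fibres fibre_measure"
  unfolding disintegration_def
proof (intro conjI ballI)
  \<comment> \<open>Phrased through the representative, the condition becomes a property of the
    fibre, and it says the same about each of its points.\<close>
  let ?good = "\<lambda>P. p' (\<phi> (representative P 0)) \<noteq> 0"
  have good: "?good (partition_proj fibres x) \<longleftrightarrow> p' (\<phi> (x 0)) \<noteq> 0" if "x \<in> space \<mu>" for x
    using that by (simp add: proj_fibres representative_fibre)
  have "AE P in quotient_measure \<mu> fibres. ?good P"
  proof (rule AE_quotient_measureI[OF partition_on_fibres])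
    have "Measurable.pred \<mu> (\<lambda>x. p' (\<phi> (x 0)) \<noteq> 0)"
      by (rule measurable_coord_comp) simp
    then show "Measurable.pred \<mu> (\<lambda>x. ?good (partition_proj fibres x))"
      using good by (simp cong: measurable_cong)
    show "AE x in \<mu>. ?good (partition_proj fibres x)"
      using AE_p'_pos by (rule AE_mp) (rule AE_I2, simp add: good)
  qed
  then show "AE P in quotient_measure \<mu> fibres.
      prob_space (fibre_measure P) \<and> sets (fibre_measure P) = sets \<mu> \<and> emeasure (fibre_measure P) P = 1"
  proof (rule AE_mp, intro AE_I2 impI)
    fix P assume "P \<in> space (quotient_measure \<mu> fibres)" and P: "?good P"
    then obtain x where x: "x \<in> space \<mu>" "P = fibre x"
      by (auto simp: fibres_eq)
    have p': "p' (\<phi> (x 0)) \<noteq> 0"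
      using P x by (simp add: representative_fibre)
    have "space (fibre_measure P) = space \<mu>"
      by (rule sets_eq_imp_space_eq) simp
    then have "prob_space (fibre_measure P)"
      using emeasure_fibre_measure_eq_1[OF x(1) p', of "space \<mu>"] mem_fibre_iff[OF x(1)] x(2)
      by (intro prob_spaceI) auto
    moreover have "emeasure (fibre_measure P) P = 1"
      unfolding x(2) using x(1) p' by (intro emeasure_fibre_measure_eq_1 sets_fibre) auto
    ultimately show "prob_space (fibre_measure P) \<and> sets (fibre_measure P) = sets \<mu> \<and>
        emeasure (fibre_measure P) P = 1"
      by simp
  qed
next
  fix A assume "A \<in> sets \<mu>"
  then show "(\<lambda>P. emeasure (fibre_measure P) A) \<in> borel_measurable (quotient_measure \<mu> fibres)"
    by (intro measurable_quotient_measureI[OF partition_on_fibres] measurable_fibre_measure)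
  show "emeasure \<mu> A = (\<integral>\<^sup>+P. emeasure (fibre_measure P) A \<partial>quotient_measure \<mu> fibres)"
    using \<open>A \<in> sets \<mu>\<close> by (rule integral_fibre_measure[symmetric])
qed

subsection \<open>The folding entropy\<close>

text \<open>The entropy of coordinate 0 given that its image is \<open>z\<close>. If
  \<open>p' z = 0\<close>, all quotients are 0 and so is the value, in line with the convention for
  the outer sum.\<close>

definition fibre_entropy :: "nat \<Rightarrow> real" where
  "fibre_entropy z = (\<Sum>s | s < m_plus \<and> \<phi> s = z. - q z s * ln (q z s))"

lemma q_entropy_nonneg: "s < m_plus \<Longrightarrow> 0 \<le> - q (\<phi> s) s * ln (q (\<phi> s) s)"
  using q_nonneg[of s "\<phi> s"] q_le_1[of s]
  by (cases "q (\<phi> s) s = 0") (auto intro!: mult_nonneg_nonpos)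

lemma fibre_entropy_nonneg: "0 \<le> fibre_entropy z"
  unfolding fibre_entropy_def using q_entropy_nonneg by (intro sum_nonneg) auto

text \<open>On the fibre a point is cut out by the cylinder of its symbol at index 0. The masses of
  \<open>m_plus\<close> cylinders thus fix the entropy of any probability measure \<open>N\<close>
  living there, whatever \<open>N\<close> does on other sets.\<close>

lemma partition_entropy_on_fibre:
  assumes x: "x \<in> space \<mu>"
    and N: "prob_space N" "sets N = sets \<mu>" "emeasure N (fibre x) = 1"
    and cyl: "\<And>s. s < m_plus \<Longrightarrow> emeasure N (cylinder m_minus m_plus 0 s) =
      emeasure (fibre_measure (fibre x)) (cylinder m_minus m_plus 0 s)"
  shows "partition_entropy N (restrict_partition (atomic_partition \<mu>) (fibre x)) =
    ennreal (fibre_entropy (\<phi> (x 0)))"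
proof -
  interpret N: prob_space N by fact
  let ?S = "{s. s < m_plus \<and> \<phi> s = \<phi> (x 0)}"
  have "AE y in N. y \<in> fibre x"
    using N x by (intro N.AE_in_set_eq_1[THEN iffD2]) (auto simp: N.emeasure_eq_measure sets_fibre)
  have meas: "measure N {x(0 := s)} = q (\<phi> (x 0)) s" if s: "s \<in> ?S" for s
  proof -
    have "y \<in> {x(0 := s)} \<longleftrightarrow> y \<in> cylinder m_minus m_plus 0 s" if "y \<in> fibre x" for y
      using that s x by (auto simp: fibre_def cylinder_eq upd_in_space)
    with \<open>AE y in N. y \<in> fibre x\<close>
    have "AE y in N. y \<in> {x(0 := s)} \<longleftrightarrow> y \<in> cylinder m_minus m_plus 0 s"
      by auto
    then have "emeasure N {x(0 := s)} = emeasure N (cylinder m_minus m_plus 0 s)"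
      using s N(2) x by (intro emeasure_eq_AE) (auto intro!: sets_singleton sets_cylinder upd_in_space)
    also have "\<dots> = ennreal (q (\<phi> (x 0)) s)"
      using s cyl emeasure_fibre_measure_cylinder[OF x, of s] by simp
    finally show ?thesis
      using s by (simp add: measure_def q_nonneg)
  qed
  have "inj_on (\<lambda>s. x(0 := s)) ?S"
    by (auto simp: inj_on_def dest: fun_upd_eqD)
  have "partition_entropy N (restrict_partition (atomic_partition \<mu>) (fibre x)) =
      (\<Sum>y\<in>fibre x. ennreal (- measure N {y} * ln (measure N {y})))"
    using mem_fibre_iff[OF x] by (intro partition_entropy_atomic finite_fibre) auto
  also have "\<dots> = (\<Sum>s\<in>?S. ennreal (- measure N {x(0 := s)} * ln (measure N {x(0 := s)})))"
    unfolding fibre_def using \<open>inj_on _ _\<close> by (subst sum.reindex) (simp_all add: o_def)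
  also have "\<dots> = (\<Sum>s\<in>?S. ennreal (- q (\<phi> (x 0)) s * ln (q (\<phi> (x 0)) s)))"
    by (intro sum.cong refl) (simp only: meas)
  also have "\<dots> = ennreal (fibre_entropy (\<phi> (x 0)))"
    unfolding fibre_entropy_def by (rule sum_ennreal) (use q_entropy_nonneg in force)
  finally show ?thesis .
qed

lemma integral_partition_entropy:
  assumes D: "disintegration \<mu> fibres D"
  shows "(\<integral>\<^sup>+P. partition_entropy (D P) (restrict_partition (atomic_partition \<mu>) P)
      \<partial>quotient_measure \<mu> fibres) = ennreal (\<Sum>z<m_minus. fibre_entropy z * p' z)"
proof -
  \<comment> \<open>A measurable function of the fibre that replaces the integrand almost
    everywhere.\<close>
  let ?G = "\<lambda>P. ennreal (fibre_entropy (\<phi> (representative P 0)))"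
  have G: "?G (partition_proj fibres x) = ennreal (fibre_entropy (\<phi> (x 0)))" if "x \<in> space \<mu>" for x
    using that by (simp add: proj_fibres representative_fibre)
  have meas: "(\<lambda>x. ?G (partition_proj fibres x)) \<in> borel_measurable \<mu>"
  proof -
    have "(\<lambda>x. ennreal (fibre_entropy (\<phi> (x 0)))) \<in> borel_measurable \<mu>"
      by (rule measurable_coord_comp) simp
    then show ?thesis
      using G by (simp cong: measurable_cong)
  qed
  \<comment> \<open>Almost everywhere uniqueness holds for one set at a time; for these finitely
    many cylinders the exceptional null sets can be united.\<close>
  have "AE P in quotient_measure \<mu> fibres. \<forall>s\<in>{..<m_plus}.
      emeasure (D P) (cylinder m_minus m_plus 0 s) =
      emeasure (fibre_measure P) (cylinder m_minus m_plus 0 s)"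
    by (intro AE_finite_allI disintegration_AE_unique[OF prob_space_\<mu> partition_on_fibres D]
        disintegration_fibre_measure sets_cylinder) simp_all
  moreover have "AE P in quotient_measure \<mu> fibres.
      prob_space (D P) \<and> sets (D P) = sets \<mu> \<and> emeasure (D P) P = 1"
    using D unfolding disintegration_def by blast
  ultimately have "AE P in quotient_measure \<mu> fibres.
      partition_entropy (D P) (restrict_partition (atomic_partition \<mu>) P) = ?G P"
    using AE_space
  proof eventually_elim
    case (elim P)
    then obtain x where x: "x \<in> space \<mu>" "P = fibre x"
      by (auto simp: fibres_eq)
    then show ?case
      using partition_entropy_on_fibre[OF x(1), of "D P"] elim
      by (simp add: representative_fibre)
  qed
  then have "(\<integral>\<^sup>+P. partition_entropy (D P) (restrict_partition (atomic_partition \<mu>) P)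
      \<partial>quotient_measure \<mu> fibres) = (\<integral>\<^sup>+P. ?G P \<partial>quotient_measure \<mu> fibres)"
    by (rule nn_integral_cong_AE)
  also have "\<dots> = (\<integral>\<^sup>+x. ?G (partition_proj fibres x) \<partial>\<mu>)"
    by (rule nn_integral_quotient_measure[OF partition_on_fibres meas])
  also have "\<dots> = (\<integral>\<^sup>+x. ennreal (fibre_entropy (\<phi> (x 0))) \<partial>\<mu>)"
    by (intro nn_integral_cong G)
  also have "\<dots> = (\<Sum>t<m_plus. ennreal (p t) * ennreal (fibre_entropy (\<phi> t)))"
    by (rule nn_integral_coord)
  also have "\<dots> = (\<Sum>t<m_plus. ennreal (fibre_entropy (\<phi> t) * p t))"
    by (intro sum.cong refl) (simp add: ennreal_mult' p_nonneg fibre_entropy_nonneg mult.commute)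
  also have "\<dots> = ennreal (\<Sum>t<m_plus. fibre_entropy (\<phi> t) * p t)"
    by (rule sum_ennreal) (simp add: p_nonneg fibre_entropy_nonneg)
  also have "(\<Sum>t<m_plus. fibre_entropy (\<phi> t) * p t) =
      (\<Sum>z<m_minus. \<Sum>t | t < m_plus \<and> \<phi> t = z. fibre_entropy (\<phi> t) * p t)"
    by (rule sum_fibres[symmetric])
  also have "\<dots> = (\<Sum>z<m_minus. fibre_entropy z * p' z)"
    unfolding push_dist_def sum_distrib_left by (intro sum.cong) auto
  finally show ?thesis .
qed

lemma folding_entropy_ext_shift:
  "folding_entropy \<mu> (ext_shift \<phi>) = ennreal (\<Sum>z<m_minus. fibre_entropy z * p' z)"
  unfolding folding_entropy_def
  by (rule cond_partition_entropy_eqI[OF disintegration_fibre_measure integral_partition_entropy])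

section \<open>The chain rule for finite distributions\<close>

lemma weighted_q_entropy:
  assumes "s < m_plus"
  shows "- q (\<phi> s) s * ln (q (\<phi> s) s) * p' (\<phi> s) = p s * ln (p' (\<phi> s)) - p s * ln (p s)"
\<comment> \<open>For \<open>p s = 0\<close> both sides are 0; otherwise
  \<open>p' (\<phi> s)\<close> is positive too and the logarithm of the quotient splits.\<close>
proof (cases "p s = 0")
  case False
  then have "p s > 0" "p' (\<phi> s) > 0"
    using p_nonneg[OF assms] p_le_p'[OF assms] by auto
  then show ?thesis
    using q_mult_p'[OF assms] by (simp add: quot_dist_def ln_div algebra_simps)
qed (simp add: quot_dist_def)

text \<open>The image under \<open>\<phi>\<close> is a function of the symbol, so the entropy of the
  symbol is that of its image plus the conditional entropy given the image.\<close>

lemma chain_rule: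
  "(\<Sum>z<m_minus. fibre_entropy z * p' z) =
    (\<Sum>s<m_plus. - p s * ln (p s)) - (\<Sum>z<m_minus. - p' z * ln (p' z))"
proof -
  have "fibre_entropy z * p' z =
      (\<Sum>s | s < m_plus \<and> \<phi> s = z. p s * ln (p' (\<phi> s)) - p s * ln (p s))" for z
    unfolding fibre_entropy_def sum_distrib_right
    by (intro sum.cong) (auto simp flip: weighted_q_entropy)
  then have "(\<Sum>z<m_minus. fibre_entropy z * p' z) =
      (\<Sum>s<m_plus. p s * ln (p' (\<phi> s)) - p s * ln (p s))"
    by (simp only: sum_fibres)
  moreover have "(\<Sum>z<m_minus. p' z * ln (p' z)) = (\<Sum>s<m_plus. p s * ln (p' (\<phi> s)))"
  proof -
    have "p' z * ln (p' z) = (\<Sum>s | s < m_plus \<and> \<phi> s = z. p s * ln (p' (\<phi> s)))" for z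
      by (subst (1) push_dist_def, subst sum_distrib_right) (auto intro: sum.cong)
    then show ?thesis
      by (simp only: sum_fibres)
  qed
  ultimately show ?thesis
    by (simp add: sum_subtractf sum_negf)
qed

end

theorem theoremB:
  fixes m_minus m_plus :: nat
    and \<phi> :: "nat \<Rightarrow> nat"
    and p :: "nat \<Rightarrow> real"
  assumes "m_minus > 0"
    and "m_plus > 0"
    and "\<phi> ` {..<m_plus} = {..<m_minus}"
    and "\<And>s. s < m_plus \<Longrightarrow> 0 \<le> p s"
    and "(\<Sum>s<m_plus. p s) = 1"
  shows "enn2ereal (folding_entropy (ext_shift_measure m_minus m_plus \<phi> p) (ext_shift \<phi>)) =
           enn2ereal (partition_entropy (ext_shift_measure m_minus m_plus \<phi> p)
             (cyl_partition m_minus m_plus 0)) -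
           enn2ereal (partition_entropy (ext_shift_measure m_minus m_plus \<phi> p)
             (cyl_partition m_minus m_plus (-1)))
       \<and> enn2ereal (partition_entropy (ext_shift_measure m_minus m_plus \<phi> p)
             (cyl_partition m_minus m_plus 0)) -
           enn2ereal (partition_entropy (ext_shift_measure m_minus m_plus \<phi> p)
             (cyl_partition m_minus m_plus (-1))) =
         ereal (\<Sum>s_minus<m_minus.
           (\<Sum>s_plus\<in>{s. s < m_plus \<and> \<phi> s = s_minus}.
              - quot_dist m_plus \<phi> p s_minus s_plus * ln (quot_dist m_plus \<phi> p s_minus s_plus))
           * push_dist m_plus \<phi> p s_minus)"
proof -
  interpret extended_shift m_minus m_plus \<phi> p
    by unfold_locales (use assms in auto)
  \<comment> \<open>\<open>ennreal\<close> sends negative reals to 0, so signs must be known before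
    values return to \<open>ereal\<close>. Both entropies are finite, hence the difference there is
    the real one.\<close>
  have nonneg: "0 \<le> (\<Sum>s<alphabet i. - weight i s * ln (weight i s))" for i
    using weight_entropy_nonneg by (intro sum_nonneg) auto
  have "enn2ereal (partition_entropy \<mu> (cyl_partition m_minus m_plus 0)) -
      enn2ereal (partition_entropy \<mu> (cyl_partition m_minus m_plus (-1))) =
      ereal (\<Sum>z<m_minus. fibre_entropy z * p' z)"
    using nonneg[of 0] nonneg[of "-1"]
    unfolding partition_entropy_cylinders chain_rule
    by (simp add: enn2ereal_ennreal alphabet_def weight_def)
  moreover have "enn2ereal (folding_entropy \<mu> (ext_shift \<phi>)) =
      ereal (\<Sum>z<m_minus. fibre_entropy z * p' z)"
    unfolding folding_entropy_ext_shift
    by (intro enn2ereal_ennreal sum_nonneg mult_nonneg_nonneg fibre_entropy_nonneg p'_nonneg)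
  ultimately show ?thesis
    unfolding fibre_entropy_def by simp
qed

end
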